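(* Let $\mathcal{D}_1=(V,E_1)$ and $\mathcal{D}_2=(V,E_2)$ be cDGs that contain every loop. The graphs $\mathcal{D}_1$ and $\mathcal{D}_2$ are Markov equivalent if and only if they have the same directed edges and are collider equivalent.
   Context: **Graphs.** A directed correlation graph (cDG) is a graph $(V,E)$ with finite node set whose edges are either directed, $\alpha\to\beta$ (loops $\alpha\to\alpha$ allowed; $\alpha\to\beta$ and $\beta\to\alpha$ are different edges), or blunt, $\alpha\vdash\!\dashv\beta$ (unordered, $\alpha\ne\beta$). Several edges of different kinds between the same two nodes are allowed. A cDG contains every loop if $\alpha\to\alpha$ is an edge for all $\alpha\in V$. A walk is an alternating sequence $\gamma_1,e_1,\gamma_2,\dots,e_k,\gamma_{k+1}$ of nodes and edges with $e_i$ an edge between $\gamma_i$ and $\gamma_{i+1}$, the direction of every directed edge (including loops) along the walk being specified; it is nontrivial if $k\ge 1$. A path is a walk on which every node occurs at most once. The edge $\alpha\to\beta$ has a head at $\beta$ and a tail at $\alpha$; the edge $\alpha\vdash\!\dashv\beta$ has a stump at both ends; an edge has a neck at a node if it has a head or a stump there. A nonendpoint node (instance) $\gamma_i$, $1<i<k+1$, is a collider on the walk if both $e_{i-1}$ and $e_i$ have a neck at $\gamma_i$, and otherwise a noncollider. A collider path is a path on which every nonendpoint node is a collider (a single edge between distinct nodes is a collider path). $\mathrm{an}(C)$ is the set of nodes from which there is a (possibly trivial) directed path to some node in $C$; so $C\subseteq\mathrm{an}(C)$. **$\mu$-separation and Markov equivalence.** A nontrivial walk from $\alpha$ to $\beta$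 is $\mu$-connecting given $C\subseteq V$ if $\alpha\notin C$, every collider is in $\mathrm{an}(C)$, no noncollider is in $C$, and the final edge has a head at $\beta$. For $A,B,C\subseteq V$, $B$ is $\mu$-separated from $A$ given $C$ if there is no $\mu$-connecting walk from any $\alpha\in A$ to any $\beta\in B$ given $C$. $\mathcal{I}(\mathcal{D})$ is the set of triples $(A,B,C)$ of subsets of $V$ such that $B$ is $\mu$-separated from $A$ given $C$ in $\mathcal{D}$. $\mathcal{D}_1,\mathcal{D}_2$ on the same node set are Markov equivalent if $\mathcal{I}(\mathcal{D}_1)=\mathcal{I}(\mathcal{D}_2)$. **Collider equivalence.** Let $\mathcal{D}_1,\mathcal{D}_2$ be cDGs on $V$ with the same directed edges (so $\mathrm{an}$ is the same in both). A nontrivial collider path in $\mathcal{D}_1$ between $\alpha$ and $\beta$ with nonendpoint nodes $\gamma_1,\dots,\gamma_{k_1}$ (possibly none) is covered in $\mathcal{D}_2$ if there is a nontrivial collider path in $\mathcal{D}_2$ between $\alpha$ and $\beta$ with nonendpoint nodes $\bar\gamma_1,\dots,\bar\gamma_{k_2}$ (possibly none) such that for each $j$, $\bar\gamma_j\in\mathrm{an}(\{\alpha,\beta\})$ or $\bar\gamma_j\in\bigcup_i\mathrm{an}(\gamma_i)$. $\mathcal{D}_1$ and $\mathcal{D}_2$ are collider equivalent if every collider path in $\mathcal{D}_1$ is covered in $\mathcal{D}_2$ and every collider path in $\mathcal{D}_2$ is covered in $\mathcal{D}_1$. *)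

theory Defs
  imports Main
begin

record 'v cdg =
  nodes :: "'v set"
  directed :: "('v \<times> 'v) set"
  blunt :: "'v set set"

definition cDG :: "'v cdg \<Rightarrow> bool" where
  "cDG G \<longleftrightarrow> finite (nodes G) \<and> directed G \<subseteq> nodes G \<times> nodes G
     \<and> (\<forall>e\<in>blunt G. \<exists>a\<in>nodes G. \<exists>b\<in>nodes G. a \<noteq> b \<and> e = {a, b})"

definition contains_every_loop :: "'v cdg \<Rightarrow> bool" where
  "contains_every_loop G \<longleftrightarrow> (\<forall>a\<in>nodes G. (a, a) \<in> directed G)"

text \<open>
  A walk is given by its list of nodes and, for each step, the kind of edge traversed:
  from \<open>a\<close> to \<open>b\<close>, \<open>Forward\<close> is the edge \<open>a \<rightarrow> b\<close>, \<open>Backward\<close> is the edge \<open>b \<rightarrow> a\<close>, and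
  \<open>Across\<close> is the blunt edge between \<open>a\<close> and \<open>b\<close>.  The two end nodes and the kind determine the
  edge; for a loop, the kind is precisely the specification of its direction along the walk.
\<close>

datatype step = Forward | Backward | Across

datatype mark = Head | Tail | Stump

fun edge :: "'v cdg \<Rightarrow> 'v \<Rightarrow> step \<Rightarrow> 'v \<Rightarrow> bool" where
  "edge G a Forward b \<longleftrightarrow> (a, b) \<in> directed G"
| "edge G a Backward b \<longleftrightarrow> (b, a) \<in> directed G"
| "edge G a Across b \<longleftrightarrow> {a, b} \<in> blunt G"

fun start_mark :: "step \<Rightarrow> mark" where
  "start_mark Forward = Tail"
| "start_mark Backward = Head"
| "start_mark Across = Stump"

fun end_mark :: "step \<Rightarrow> mark" where
  "end_mark Forward = Head"
| "end_mark Backward = Tail"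
| "end_mark Across = Stump"

definition neck :: "mark \<Rightarrow> bool" where
  "neck m \<longleftrightarrow> m = Head \<or> m = Stump"

definition walk :: "'v cdg \<Rightarrow> 'v \<Rightarrow> 'v list \<Rightarrow> step list \<Rightarrow> 'v \<Rightarrow> bool" where
  "walk G a ns ss b \<longleftrightarrow> length ns = Suc (length ss) \<and> set ns \<subseteq> nodes G
     \<and> hd ns = a \<and> last ns = b \<and> (\<forall>i<length ss. edge G (ns ! i) (ss ! i) (ns ! Suc i))"

definition path :: "'v cdg \<Rightarrow> 'v \<Rightarrow> 'v list \<Rightarrow> step list \<Rightarrow> 'v \<Rightarrow> bool" where
  "path G a ns ss b \<longleftrightarrow> walk G a ns ss b \<and> distinct ns"

text \<open>
  Positions are counted from \<open>0\<close>, so the nonendpoint instances on a walk with steps \<open>ss\<close> are those at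
  positions \<open>i\<close> with \<open>0 < i < length ss\<close>; being a collider depends on the steps only.
\<close>

definition collider_at :: "step list \<Rightarrow> nat \<Rightarrow> bool" where
  "collider_at ss i \<longleftrightarrow> 0 < i \<and> i < length ss
     \<and> neck (end_mark (ss ! (i - 1))) \<and> neck (start_mark (ss ! i))"

definition noncollider_at :: "step list \<Rightarrow> nat \<Rightarrow> bool" where
  "noncollider_at ss i \<longleftrightarrow> 0 < i \<and> i < length ss \<and> \<not> collider_at ss i"

definition an :: "'v cdg \<Rightarrow> 'v set \<Rightarrow> 'v set" where
  "an G C = {a. \<exists>c\<in>C. \<exists>ns ss. path G a ns ss c \<and> (\<forall>s\<in>set ss. s = Forward)}"

definition mu_connecting ::
  "'v cdg \<Rightarrow> 'v \<Rightarrow> 'v list \<Rightarrow> step list \<Rightarrow> 'v \<Rightarrow> 'v set \<Rightarrow> bool" where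
  "mu_connecting G a ns ss b C \<longleftrightarrow> walk G a ns ss b \<and> ss \<noteq> [] \<and> a \<notin> C
     \<and> (\<forall>i. collider_at ss i \<longrightarrow> ns ! i \<in> an G C)
     \<and> (\<forall>i. noncollider_at ss i \<longrightarrow> ns ! i \<notin> C)
     \<and> end_mark (last ss) = Head"

definition mu_separated :: "'v cdg \<Rightarrow> 'v set \<Rightarrow> 'v set \<Rightarrow> 'v set \<Rightarrow> bool" where
  "mu_separated G A B C \<longleftrightarrow>
     \<not> (\<exists>a\<in>A. \<exists>b\<in>B. \<exists>ns ss. mu_connecting G a ns ss b C)"

definition independence_model :: "'v cdg \<Rightarrow> ('v set \<times> 'v set \<times> 'v set) set" where
  "independence_model G = {(A, B, C). A \<subseteq> nodes G \<and> B \<subseteq> nodes G \<and> C \<subseteq> nodes G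
     \<and> mu_separated G A B C}"

definition Markov_equivalent :: "'v cdg \<Rightarrow> 'v cdg \<Rightarrow> bool" where
  "Markov_equivalent G H \<longleftrightarrow> independence_model G = independence_model H"

definition nontrivial_collider_path ::
  "'v cdg \<Rightarrow> 'v \<Rightarrow> 'v list \<Rightarrow> step list \<Rightarrow> 'v \<Rightarrow> bool" where
  "nontrivial_collider_path G a ns ss b \<longleftrightarrow> path G a ns ss b \<and> ss \<noteq> []
     \<and> (\<forall>i. 0 < i \<and> i < length ss \<longrightarrow> collider_at ss i)"

definition nonendpoints :: "'v list \<Rightarrow> 'v set" where
  "nonendpoints ns = set (butlast (tl ns))"

text \<open>
  Covering is only meant for graphs with the same nodes and the same directed edges, so it does not
  matter in which of the two graphs ancestors are taken.
\<close>

definition covered_in ::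
  "'v cdg \<Rightarrow> 'v cdg \<Rightarrow> 'v \<Rightarrow> 'v list \<Rightarrow> 'v \<Rightarrow> bool" where
  "covered_in G H a ns b \<longleftrightarrow> (\<exists>ns' ss'. nontrivial_collider_path H a ns' ss' b
     \<and> (\<forall>d\<in>nonendpoints ns'. d \<in> an G {a, b} \<or> d \<in> (\<Union>c\<in>nonendpoints ns. an G {c})))"

definition collider_equivalent :: "'v cdg \<Rightarrow> 'v cdg \<Rightarrow> bool" where
  "collider_equivalent G H \<longleftrightarrow>
     (\<forall>a b ns ss. nontrivial_collider_path G a ns ss b \<longrightarrow> covered_in G H a ns b)
   \<and> (\<forall>a b ns ss. nontrivial_collider_path H a ns ss b \<longrightarrow> covered_in H G a ns b)"

end

theory Submission
  imports Defs
begin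

text \<open>
  Fix a conditioning set \<open>C\<close>.  A walk is \<open>\<mu>\<close>-connecting exactly if it consists of a walk from \<open>a\<close> to
  some node \<open>v\<close> outside \<open>C\<close> that is open given \<open>C\<close>, followed by an edge \<open>v \<rightarrow> b\<close>: the last edge has a
  tail at \<open>v\<close>, so \<open>v\<close> can only be the start or a noncollider (\<open>mu_connected_iff_reach\<close>).  What has
  to be compared in the two graphs is therefore the open connection between two nodes outside \<open>C\<close>,
  with no constraint on the mark at its end.

  Given \<open>V - {a}\<close> every noncollider must be \<open>a\<close>, so \<open>a\<close> is \<open>\<mu>\<close>-connected to \<open>b\<close> only by an edge
  \<open>a \<rightarrow> b\<close>.  Hence the independence model determines the directed edges, and with them the ancestors.

  Let \<open>D1\<close> and \<open>D2\<close> be Markov equivalent, and take a collider path in \<open>D1\<close> between \<open>a\<close> and \<open>b\<close>.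
  Let \<open>S\<close> be the set of ancestors of its nodes and condition on \<open>C = S - {a, b}\<close>.  The path,
  prolonged by the loop at \<open>b\<close>, is \<open>\<mu>\<close>-connecting in \<open>D1\<close>, so there is a \<open>\<mu>\<close>-connecting walk in \<open>D2\<close>.
  From a noncollider one can follow directed edges along the walk until a collider or an end node is
  reached, so all nodes of the walk are in \<open>S\<close> (\<open>reach_within_ancestral\<close>), and its noncolliders are in
  \<open>S - C \<subseteq> {a, b}\<close>.  Cutting out everything before the last visit to \<open>a\<close>, after the next visit to
  \<open>b\<close>, and between repeated visits to a node leaves a collider path inside \<open>S\<close>
  (\<open>collider_path_of_reach\<close>), which covers the given one.

  Conversely, let the graphs be collider equivalent with the same directed edges, and take an open
  walk in \<open>D1\<close> from \<open>a\<close> to \<open>v\<close>.  Its nodes are in \<open>S = an ({a, v} \<union> C)\<close>.  Its noncolliders cut it into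
  stretches that can be replaced by collider paths of \<open>D2\<close>, again inside \<open>S\<close> as \<open>S\<close> is closed under
  ancestors (\<open>reach_transfer\<close>).  The new walk need not be open: marks at the cutting nodes may have
  changed, and colliders are only known to be in \<open>S\<close>.  But a collider outside \<open>an C\<close> has a directed path
  to \<open>a\<close> or to \<open>v\<close>, and this path avoids \<open>C\<close>, so it can serve as a new beginning or a new end of the
  walk (\<open>reach_repair\<close>).
\<close>

section \<open>Walks with prescribed colliders and noncolliders\<close>

definition open_walk ::
  "'v cdg \<Rightarrow> 'v set \<Rightarrow> 'v set \<Rightarrow> 'v \<Rightarrow> 'v list \<Rightarrow> step list \<Rightarrow> 'v \<Rightarrow> bool" where
  "open_walk G N M a ns ss b \<longleftrightarrow> walk G a ns ss b
     \<and> (\<forall>i. collider_at ss i \<longrightarrow> ns ! i \<in> M) \<and> (\<forall>i. noncollider_at ss i \<longrightarrow> ns ! i \<in> N)"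

lemma collider_at_append: "i < length ss \<Longrightarrow> collider_at (ss @ ts) i \<longleftrightarrow> collider_at ss i"
  by (auto simp: collider_at_def nth_append)

lemma collider_at_take: "i < n \<Longrightarrow> collider_at (take n ss) i \<longleftrightarrow> collider_at ss i"
  by (auto simp: collider_at_def)

lemma collider_at_snoc_end:
  "collider_at (ss @ [s]) (length ss) \<longleftrightarrow>
    ss \<noteq> [] \<and> neck (end_mark (last ss)) \<and> neck (start_mark s)"
  by (auto simp: collider_at_def nth_append last_conv_nth)

lemma walk_last_nth: "walk G a ns ss b \<Longrightarrow> ns ! length ss = b"
  unfolding walk_def by (metis diff_Suc_1 last_conv_nth length_0_conv nat.distinct(1))

lemma walk_hd_nth: "walk G a ns ss b \<Longrightarrow> ns ! 0 = a"
  unfolding walk_def by (metis hd_conv_nth length_0_conv nat.distinct(1))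

lemma open_walk_trivial: "a \<in> nodes G \<Longrightarrow> open_walk G N M a [a] [] a"
  by (simp add: open_walk_def walk_def collider_at_def noncollider_at_def)

lemma open_walk_snoc:
  assumes "open_walk G N M a ns ss u" "edge G u s w" "w \<in> nodes G"
    and "ss \<noteq> [] \<Longrightarrow> u \<in> (if neck (end_mark (last ss)) \<and> neck (start_mark s) then M else N)"
  shows "open_walk G N M a (ns @ [w]) (ss @ [s]) w"
proof -
  have W: "walk G a ns ss u" using assms(1) by (simp add: open_walk_def)
  then have len: "length ns = Suc (length ss)" by (simp add: walk_def)
  have u: "ns ! length ss = u" using walk_last_nth[OF W] .
  have "edge G ((ns @ [w]) ! i) ((ss @ [s]) ! i) ((ns @ [w]) ! Suc i)" if "i < Suc (length ss)" for i
  proof (cases "i = length ss")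
    case True
    then show ?thesis using assms(2) len u by (simp add: nth_append)
  next
    case False
    then show ?thesis using that W len by (simp add: nth_append walk_def)
  qed
  then have W': "walk G a (ns @ [w]) (ss @ [s]) w"
    using W assms(3) by (auto simp: walk_def hd_append)
  have split: "(ns @ [w]) ! i \<in> (if collider_at (ss @ [s]) i then M else N)"
    if "0 < i" "i < Suc (length ss)" for i
  proof (cases "i = length ss")
    case True
    with that have "ss \<noteq> []" by auto
    then show ?thesis using True assms(4) len u by (simp add: nth_append collider_at_snoc_end)
  next
    case False
    then have "i < length ss" using that by simp
    then show ?thesis using assms(1) that len
      by (auto simp: nth_append collider_at_append open_walk_def noncollider_at_def)
  qed
  have "(ns @ [w]) ! i \<in> M" if "collider_at (ss @ [s]) i" for i
    using split[of i] that by (auto simp: collider_at_def)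
  moreover have "(ns @ [w]) ! i \<in> N" if "noncollider_at (ss @ [s]) i" for i
    using split[of i] that by (auto simp: noncollider_at_def)
  ultimately show ?thesis using W' by (simp add: open_walk_def)
qed

lemma open_walk_take:
  assumes "open_walk G N M a ns ss u" "i < length ns"
  shows "open_walk G N M a (take (Suc i) ns) (take i ss) (ns ! i)"
proof -
  have W: "walk G a ns ss u" using assms(1) by (simp add: open_walk_def)
  then have len: "length ns = Suc (length ss)" by (simp add: walk_def)
  have lt: "length (take i ss) = i" using assms(2) len by simp
  have "walk G a (take (Suc i) ns) (take i ss) (ns ! i)"
    unfolding walk_def lt
  proof (intro conjI allI impI)
    show "length (take (Suc i) ns) = Suc i" using assms(2) by simp
    show "set (take (Suc i) ns) \<subseteq> nodes G" using W by (auto simp: walk_def dest: in_set_takeD)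
    show "hd (take (Suc i) ns) = a" using W by (simp add: walk_def)
    show "last (take (Suc i) ns) = ns ! i" using assms(2) by (simp add: take_Suc_conv_app_nth)
    show "edge G (take (Suc i) ns ! j) (take i ss ! j) (take (Suc i) ns ! Suc j)" if "j < i" for j
      using W that assms(2) len by (simp add: walk_def)
  qed
  moreover have "take (Suc i) ns ! j \<in> M" if "collider_at (take i ss) j" for j
  proof -
    have "j < i" using that by (simp add: collider_at_def)
    then show ?thesis using that assms(1) by (simp add: collider_at_take open_walk_def)
  qed
  moreover have "take (Suc i) ns ! j \<in> N" if "noncollider_at (take i ss) j" for j
  proof -
    have "j < i" using that by (simp add: noncollider_at_def)
    then show ?thesis
      using that assms(1) by (auto simp: collider_at_take open_walk_def noncollider_at_def)
  qed
  ultimately show ?thesis by (simp add: open_walk_def)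
qed

lemma nonendpoints_conv_nth:
  assumes "length ns = Suc (length ss)"
  shows "nonendpoints ns = {ns ! i | i. 0 < i \<and> i < length ss}"
proof -
  have l: "length (butlast (tl ns)) = length ss - 1" using assms by simp
  have nth: "butlast (tl ns) ! i = ns ! Suc i" if "i < length ss - 1" for i
    using that assms by (simp add: nth_butlast nth_tl)
  show ?thesis
  proof (intro set_eqI iffI)
    fix x assume "x \<in> nonendpoints ns"
    then obtain i where i: "i < length ss - 1" "x = butlast (tl ns) ! i"
      unfolding nonendpoints_def in_set_conv_nth l by blast
    then have "x = ns ! Suc i" "0 < Suc i" "Suc i < length ss" using nth by auto
    then show "x \<in> {ns ! i | i. 0 < i \<and> i < length ss}" by blast
  next
    fix x assume "x \<in> {ns ! i | i. 0 < i \<and> i < length ss}"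
    then obtain i where i: "0 < i" "i < length ss" "x = ns ! i" by blast
    then have "i - 1 < length ss - 1" "x = butlast (tl ns) ! (i - 1)" using nth[of "i - 1"] by auto
    then show "x \<in> nonendpoints ns" unfolding nonendpoints_def in_set_conv_nth l by blast
  qed
qed

lemma open_collider_path_iff:
  "path G a ns ss b \<and> ss \<noteq> [] \<and> open_walk G {} M a ns ss b \<longleftrightarrow>
    nontrivial_collider_path G a ns ss b \<and> nonendpoints ns \<subseteq> M"
proof (cases "walk G a ns ss b")
  case True
  then have "nonendpoints ns = {ns ! i | i. 0 < i \<and> i < length ss}"
    by (simp add: nonendpoints_conv_nth walk_def)
  then show ?thesis
    by (auto simp: open_walk_def path_def nontrivial_collider_path_def noncollider_at_def
        collider_at_def)
next
  case False
  then show ?thesis by (simp add: path_def nontrivial_collider_path_def)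
qed

section \<open>Ancestors\<close>

lemma an_conv_rtrancl:
  assumes "cDG G"
  shows "an G C = {x \<in> nodes G. \<exists>c\<in>C. (x, c) \<in> (directed G)\<^sup>*}"
proof (intro set_eqI iffI)
  fix x assume "x \<in> an G C"
  then obtain c ns ss where c: "c \<in> C" and p: "path G x ns ss c" and fw: "\<forall>s\<in>set ss. s = Forward"
    by (auto simp: an_def)
  have W: "walk G x ns ss c" using p by (simp add: path_def)
  have "(ns ! 0, ns ! i) \<in> (directed G)\<^sup>*" if "i \<le> length ss" for i
    using that
  proof (induction i)
    case (Suc i)
    then have "ss ! i = Forward" using fw by simp
    then have "(ns ! i, ns ! Suc i) \<in> directed G" using W Suc.prems
      by (metis Suc_le_lessD edge.simps(1) walk_def)
    then show ?case using Suc by simp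
  qed simp
  from this[of "length ss"] have "(x, c) \<in> (directed G)\<^sup>*"
    using walk_hd_nth[OF W] walk_last_nth[OF W] by simp
  moreover have "x \<in> nodes G" using W unfolding walk_def
    by (metis hd_in_set length_0_conv nat.distinct(1) subsetD)
  ultimately show "x \<in> {x \<in> nodes G. \<exists>c\<in>C. (x, c) \<in> (directed G)\<^sup>*}" using c by auto
next
  fix x assume "x \<in> {x \<in> nodes G. \<exists>c\<in>C. (x, c) \<in> (directed G)\<^sup>*}"
  then obtain c where x: "x \<in> nodes G" and c: "c \<in> C" and r: "(x, c) \<in> (directed G)\<^sup>*" by auto
  from r have "\<exists>ns ss. path G x ns ss c \<and> (\<forall>s\<in>set ss. s = Forward)"
  proof (induction rule: rtrancl_induct)
    case base
    have "path G x [x] [] x" using x by (simp add: path_def walk_def)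
    then show ?case by fastforce
  next
    case (step y z)
    then obtain ns ss where p: "path G x ns ss y" and fw: "\<forall>s\<in>set ss. s = Forward" by auto
    have W: "open_walk G UNIV UNIV x ns ss y" using p by (simp add: path_def open_walk_def)
    have z: "z \<in> nodes G" using step.hyps(2) assms by (auto simp: cDG_def)
    show ?case
    proof (cases "z \<in> set ns")
      case True
      then obtain i where i: "i < length ns" "ns ! i = z" by (auto simp: in_set_conv_nth)
      have "path G x (take (Suc i) ns) (take i ss) z"
        using open_walk_take[OF W i(1)] i p by (simp add: path_def open_walk_def)
      then show ?thesis using fw by (blast dest: in_set_takeD)
    next
      case False
      have "open_walk G UNIV UNIV x (ns @ [z]) (ss @ [Forward]) z"
        using open_walk_snoc[OF W _ z] step.hyps(2) by simp
      then have "path G x (ns @ [z]) (ss @ [Forward]) z"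
        using False p by (simp add: path_def open_walk_def)
      moreover have "\<forall>s\<in>set (ss @ [Forward]). s = Forward" using fw by auto
      ultimately show ?thesis by blast
    qed
  qed
  then show "x \<in> an G C" using c by (auto simp: an_def)
qed

lemma an_subset_nodes: "cDG G \<Longrightarrow> an G C \<subseteq> nodes G"
  by (auto simp: an_conv_rtrancl)

lemma subset_an: "cDG G \<Longrightarrow> x \<in> C \<Longrightarrow> x \<in> nodes G \<Longrightarrow> x \<in> an G C"
  by (auto simp: an_conv_rtrancl)

lemma an_directed: "cDG G \<Longrightarrow> (x, y) \<in> directed G \<Longrightarrow> y \<in> an G C \<Longrightarrow> x \<in> an G C"
  by (auto simp: an_conv_rtrancl cDG_def intro: converse_rtrancl_into_rtrancl)

lemma an_an: "cDG G \<Longrightarrow> B \<subseteq> an G C \<Longrightarrow> an G B \<subseteq> an G C"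
  unfolding an_conv_rtrancl by (blast intro: rtrancl_trans)

lemma an_mono: "B \<subseteq> C \<Longrightarrow> an G B \<subseteq> an G C"
  by (auto simp: an_def)

lemma an_same_directed:
  assumes "cDG G" "cDG H" "nodes G = nodes H" "directed G = directed H"
  shows "an G C = an H C"
  using assms by (simp add: an_conv_rtrancl)

section \<open>Reachability by open walks\<close>

text \<open>
  Whether a walk can be prolonged depends only on its last node and on whether it has a neck there.
  Recording just this pair turns walk surgery into rule induction.  The trivial walk counts as having
  no neck, which makes the start behave as a noncollider: it has to lie in \<open>N\<close> as soon as it is left.
\<close>

inductive reach :: "'v cdg \<Rightarrow> 'v set \<Rightarrow> 'v set \<Rightarrow> 'v \<Rightarrow> 'v \<Rightarrow> bool \<Rightarrow> bool" for G N M a where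
  start: "a \<in> nodes G \<Longrightarrow> reach G N M a a False"
| step: "reach G N M a u k \<Longrightarrow> edge G u s w \<Longrightarrow> w \<in> nodes G \<Longrightarrow>
    u \<in> (if k \<and> neck (start_mark s) then M else N) \<Longrightarrow> reach G N M a w (neck (end_mark s))"

lemma reach_mono:
  assumes "reach G N M a u k" "N \<subseteq> N'" "M \<subseteq> M'"
  shows "reach G N' M' a u k"
  using assms(1)
proof induction
  case (step u k s w)
  have "u \<in> (if k \<and> neck (start_mark s) then M' else N')"
    using step.hyps assms(2,3) by (auto split: if_splits)
  then show ?case using step reach.step by metis
qed (rule reach.start)

lemma reach_in_nodes: "reach G N M a u k \<Longrightarrow> u \<in> nodes G"
  by (induction rule: reach.induct) auto

lemma reach_forward:
  assumes "reach G N M a u k" "(u, w) \<in> directed G" "w \<in> nodes G" "u \<in> N"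
  shows "reach G N M a w True"
  using reach.step[OF assms(1), of Forward w] assms(2-) by (simp add: neck_def)

text \<open>
  The node where the walks are joined may become a collider or a noncollider, so it has to be allowed
  as both.
\<close>

lemma reach_trans:
  assumes "reach G N M a j k" "j \<in> N" "j \<in> M" "reach G N M j u k'"
  shows "\<exists>k. reach G N M a u k"
proof -
  from assms(4) have "u = j \<or> reach G N M a u k'"
  proof induction
    case (step u k' s w)
    show ?case
    proof (cases "u = j")
      case True
      have "j \<in> (if k \<and> neck (start_mark s) then M else N)" using assms by simp
      then have "reach G N M a w (neck (end_mark s))"
        using reach.step[OF assms(1)] step.hyps True by blast
      then show ?thesis ..
    next
      case False
      then show ?thesis using step reach.step by metis
    qed
  qed simp
  then show ?thesis using assms(1) by blast
qed

lemma open_walk_imp_reach: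
  assumes "open_walk G N M a ns ss b" "ss \<noteq> [] \<Longrightarrow> a \<in> N" "i \<le> length ss"
  shows "reach G N M a (ns ! i) (0 < i \<and> neck (end_mark (ss ! (i - 1))))"
  using assms(3)
proof (induction i)
  case 0
  have W: "walk G a ns ss b" using assms(1) by (simp add: open_walk_def)
  then have "ns ! 0 \<in> nodes G" unfolding walk_def by (metis nth_mem subsetD zero_less_Suc)
  then show ?case using walk_hd_nth[OF W] reach.start by simp
next
  case (Suc i)
  have W: "walk G a ns ss b" using assms(1) by (simp add: open_walk_def)
  have e: "edge G (ns ! i) (ss ! i) (ns ! Suc i)" using W Suc.prems by (simp add: walk_def)
  have n: "ns ! Suc i \<in> nodes G" using W Suc.prems unfolding walk_def
    by (metis less_Suc_eq_le nth_mem subsetD)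
  have "ns ! i \<in> (if (0 < i \<and> neck (end_mark (ss ! (i - 1)))) \<and> neck (start_mark (ss ! i))
      then M else N)"
  proof (cases "i = 0")
    case True
    have "ss \<noteq> []" using Suc.prems by auto
    then show ?thesis using True assms(2) walk_hd_nth[OF W] by simp
  next
    case False
    then show ?thesis using assms(1) Suc.prems
      by (auto simp: open_walk_def collider_at_def noncollider_at_def)
  qed
  from reach.step[OF Suc.IH e n this] Suc.prems show ?case by simp
qed

lemma reach_imp_open_walk:
  assumes "reach G N M a u k"
  shows "\<exists>ns ss. open_walk G N M a ns ss u \<and> (k \<longleftrightarrow> ss \<noteq> [] \<and> neck (end_mark (last ss)))"
  using assms
proof induction
  case start
  then show ?case using open_walk_trivial by fastforce
next
  case (step u k s w)
  then obtain ns ss where o: "open_walk G N M a ns ss u"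
    and k: "k \<longleftrightarrow> ss \<noteq> [] \<and> neck (end_mark (last ss))" by auto
  have "open_walk G N M a (ns @ [w]) (ss @ [s]) w"
    by (rule open_walk_snoc[OF o step.hyps(2,3)]) (use step.hyps(4) k in simp)
  then show ?case by fastforce
qed

lemma mu_connected_iff_reach:
  assumes "cDG G"
  shows "(\<exists>ns ss. mu_connecting G a ns ss b C) \<longleftrightarrow>
    a \<notin> C \<and> (\<exists>v k. reach G (- C) (an G C) a v k \<and> v \<notin> C \<and> (v, b) \<in> directed G)"
proof (intro iffI; (elim exE conjE)?)
  fix ns ss assume mu: "mu_connecting G a ns ss b C"
  then have o: "open_walk G (- C) (an G C) a ns ss b" and a: "a \<notin> C" and ne: "ss \<noteq> []"
    and hd: "end_mark (last ss) = Head"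
    by (auto simp: mu_connecting_def open_walk_def)
  have W: "walk G a ns ss b" using o by (simp add: open_walk_def)
  define n where "n = length ss - 1"
  have len: "length ss = Suc n" using ne by (simp add: n_def)
  have "last ss = Forward" using hd by (cases "last ss") auto
  then have fw: "ss ! n = Forward" using ne by (simp add: last_conv_nth n_def)
  have "reach G (- C) (an G C) a (ns ! n) (0 < n \<and> neck (end_mark (ss ! (n - 1))))"
    using open_walk_imp_reach[OF o, of n] a len by simp
  moreover have "ns ! n \<notin> C"
  proof (cases "n = 0")
    case True
    then show ?thesis using walk_hd_nth[OF W] a by simp
  next
    case False
    then have "noncollider_at ss n"
      using len fw by (simp add: noncollider_at_def collider_at_def neck_def)
    then show ?thesis using o by (auto simp: open_walk_def)
  qed
  moreover have "(ns ! n, b) \<in> directed G"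
    using W walk_last_nth[OF W] fw len unfolding walk_def by (metis edge.simps(1) lessI)
  ultimately show "a \<notin> C \<and> (\<exists>v k. reach G (- C) (an G C) a v k \<and> v \<notin> C \<and> (v, b) \<in> directed G)"
    using a by blast
next
  fix v k assume a: "a \<notin> C" and r: "reach G (- C) (an G C) a v k" and v: "v \<notin> C"
    and d: "(v, b) \<in> directed G"
  obtain ns ss where o: "open_walk G (- C) (an G C) a ns ss v"
    using reach_imp_open_walk[OF r] by blast
  have "b \<in> nodes G" using d assms by (auto simp: cDG_def)
  then have "open_walk G (- C) (an G C) a (ns @ [b]) (ss @ [Forward]) b"
    using open_walk_snoc[OF o, of Forward b] d v by (simp add: neck_def)
  then have "mu_connecting G a (ns @ [b]) (ss @ [Forward]) b C"
    using a by (auto simp: mu_connecting_def open_walk_def)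
  then show "\<exists>ns ss. mu_connecting G a ns ss b C" by blast
qed

section \<open>Collider paths and reachability\<close>

lemma reach_of_collider_path:
  assumes "nontrivial_collider_path G a ns ss b" "nonendpoints ns \<subseteq> M"
  shows "\<exists>k. reach G {a} M a b k"
proof -
  have "open_walk G {} M a ns ss b"
    using assms open_collider_path_iff[of G a ns ss b M] by simp
  then have o: "open_walk G {a} M a ns ss b" by (auto simp: open_walk_def)
  then have "ns ! length ss = b" using walk_last_nth by (auto simp: open_walk_def)
  then show ?thesis using open_walk_imp_reach[OF o, of "length ss"] by auto
qed

text \<open>
  While following the walk, keep a collider path from \<open>a\<close> to the current node: restart at each visit
  to \<open>a\<close>, stop at \<open>b\<close>, and cut back when a node is revisited.  Any other node can only be left as a
  collider, so the walk enters it with a neck whenever it goes on.  The path kept then enters it with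
  a neck as well: a node to which the path is cut back is a collider on it, or is the last node and is
  revisited by a loop, having been left as a collider.
\<close>

lemma collider_path_of_reach:
  assumes "reach G {a, b} M a b k" "a \<noteq> b"
  shows "\<exists>ns ss. nontrivial_collider_path G a ns ss b \<and> nonendpoints ns \<subseteq> M"
proof -
  let ?P = "\<lambda>u ns ss. path G a ns ss u \<and> open_walk G {} M a ns ss u"
  let ?done = "\<exists>ns ss. nontrivial_collider_path G a ns ss b \<and> nonendpoints ns \<subseteq> M"
  have "?done \<or> (u \<noteq> b \<and>
      (\<exists>ns ss. ?P u ns ss \<and> (k \<and> u \<noteq> a \<longrightarrow> ss \<noteq> [] \<and> neck (end_mark (last ss)))))"
    if "reach G {a, b} M a u k" for u k
    using that
  proof induction
    case start
    have "?P a [a] []"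
      using start open_walk_trivial[OF start, of "{}" M] by (simp add: path_def open_walk_def)
    then show ?case using assms(2) by blast
  next
    case (step u k s w)
    show ?case
    proof (cases ?done)
      case False
      then obtain ns ss where u: "u \<noteq> b" and P: "?P u ns ss"
        and nk: "k \<and> u \<noteq> a \<longrightarrow> ss \<noteq> [] \<and> neck (end_mark (last ss))"
        using step.IH by blast
      have len: "length ns = Suc (length ss)" using P by (simp add: path_def walk_def)
      have ns0: "ns ! 0 = a" and nsl: "ns ! length ss = u"
        using P walk_hd_nth walk_last_nth by (auto simp: path_def)
      have dist: "distinct ns" using P by (simp add: path_def)
      have interior: "k \<and> neck (start_mark s) \<and> u \<in> M \<and> ss \<noteq> [] \<and> neck (end_mark (last ss))"
        if "u \<noteq> a" using that u step.hyps(4) nk by (auto split: if_splits)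
      have start_only: "ss = []" if "u = a"
        using that dist ns0 nsl len by (auto simp: distinct_conv_nth)
      have ext: "?P w (ns @ [w]) (ss @ [s])" if "w \<notin> set ns"
      proof -
        have "open_walk G {} M a (ns @ [w]) (ss @ [s]) w"
        proof (rule open_walk_snoc)
          show "open_walk G {} M a ns ss u" using P by blast
          show "u \<in> (if neck (end_mark (last ss)) \<and> neck (start_mark s) then M else {})"
            if "ss \<noteq> []" using that interior start_only by auto
        qed (fact step.hyps(2) step.hyps(3))+
        then show ?thesis using that dist by (simp add: path_def open_walk_def)
      qed
      show ?thesis
      proof (cases "w \<in> set ns")
        case True
        then obtain i where i: "i < length ns" "ns ! i = w" by (auto simp: in_set_conv_nth)
        have P': "?P w (take (Suc i) ns) (take i ss)"
          using open_walk_take[of G "{}" M a ns ss u i] P i by (simp add: path_def open_walk_def)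
        show ?thesis
        proof (cases "w = b")
          case True
          then have "i \<noteq> 0" using i ns0 assms(2) by metis
          then have "ss \<noteq> []" using i len by auto
          then have "nontrivial_collider_path G a (take (Suc i) ns) (take i ss) b
              \<and> nonendpoints (take (Suc i) ns) \<subseteq> M"
            using P' True \<open>i \<noteq> 0\<close> open_collider_path_iff[of G a "take (Suc i) ns" "take i ss" b M]
            by simp
          then show ?thesis by blast
        next
          case False
          have "take i ss \<noteq> [] \<and> neck (end_mark (last (take i ss)))" if "w \<noteq> a"
          proof -
            have i0: "0 < i" using that i ns0 by (metis gr0I)
            have ne: "ss \<noteq> []" using i0 i len by auto
            have "neck (end_mark (ss ! (i - 1)))"
            proof (cases "i = length ss")
              case True
              then have "w = u" using nsl i by simp
              then show ?thesis using interior that True ne by (simp add: last_conv_nth)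
            next
              case False
              then have "i < length ss" using i len by simp
              then have "\<not> noncollider_at ss i" using P by (auto simp: open_walk_def)
              then show ?thesis
                using i0 \<open>i < length ss\<close> by (simp add: noncollider_at_def collider_at_def)
            qed
            then show ?thesis using i0 ne i len by (simp add: last_conv_nth min_absorb2)
          qed
          then show ?thesis using P' False by blast
        qed
      next
        case False
        show ?thesis
        proof (cases "w = b")
          case True
          have "path G a (ns @ [w]) (ss @ [s]) b \<and> ss @ [s] \<noteq> []
              \<and> open_walk G {} M a (ns @ [w]) (ss @ [s]) b"
            using ext[OF False] True by simp
          then show ?thesis
            using open_collider_path_iff[of G a "ns @ [w]" "ss @ [s]" b M] by blast
        next
          case wb: False
          have "neck (end_mark s) \<and> w \<noteq> a \<longrightarrow> ss @ [s] \<noteq> [] \<and> neck (end_mark (last (ss @ [s])))"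
            by simp
          then show ?thesis using ext[OF False] wb by blast
        qed
      qed
    qed simp
  qed
  from this[OF assms(1)] show ?thesis by blast
qed

text \<open>
  A walk that has no neck at its last node ends with steps against directed edges, starting at \<open>a\<close> or
  at a collider; so its last node is an ancestor of \<open>a\<close> or of \<open>C\<close>, hence in \<open>S\<close>.  A noncollider with
  a neck at its entry is left along a directed edge and inherits membership in \<open>S\<close> from the next node.
\<close>

lemma reach_within_ancestral:
  assumes "cDG G" and S: "S = an G B" and "a \<in> S" "an G C \<subseteq> S"
    and r: "reach G (- C) (an G C) a u k" and "u \<in> S"
  shows "reach G (S - C) S a u k"
proof -
  have tail: "u \<in> S" if "reach G (- C) (an G C) a u k" "\<not> k" for u k
    using that
  proof induction
    case (step u k s w)
    then have s: "s = Backward" by (cases s) (auto simp: neck_def)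
    have "u \<in> S"
      using step s assms(4) by (cases k) (auto simp: neck_def)
    moreover have "(w, u) \<in> directed G" using step.hyps(2) s by simp
    ultimately show ?case using an_directed[OF assms(1)] S by blast
  qed (use assms(3) in simp)
  from r \<open>u \<in> S\<close> show ?thesis
  proof induction
    case start
    then show ?case by (simp add: reach.start)
  next
    case (step u k s w)
    have "u \<in> S"
    proof (cases "k \<and> neck (start_mark s)")
      case True
      then show ?thesis using step.hyps(4) assms(4) by auto
    next
      case False
      then consider "\<not> k" | "s = Forward" by (cases s) (auto simp: neck_def)
      then show ?thesis
      proof cases
        case 1
        then show ?thesis using tail step.hyps(1) by blast
      next
        case 2
        then show ?thesis using step.hyps(2) step.prems an_directed[OF assms(1)] S by simp
      qed
    qed
    then have "u \<in> (if k \<and> neck (start_mark s) then S else S - C)"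
      using step.hyps(4) by (auto split: if_splits)
    then show ?case using reach.step[OF step.IH[OF \<open>u \<in> S\<close>] step.hyps(2,3)] by blast
  qed
qed

text \<open>
  The induction keeps the last noncollider \<open>j\<close>, up to which the walk has been transferred, and
  the stretch of colliders since then.  The nodes at which stretches meet are both in \<open>S\<close> and
  outside \<open>C\<close>, so whatever marks the covering paths have there is harmless.
\<close>

lemma reach_transfer:
  assumes "cDG G" "cDG H" "nodes G = nodes H"
    and S: "S = an G B"
    and cov: "\<And>x y ns ss. nontrivial_collider_path G x ns ss y \<Longrightarrow> covered_in G H x ns y"
    and r: "reach G (S - C) S a v k" and a: "a \<in> S - C" and v: "v \<in> S - C"
  shows "\<exists>k. reach H (S - C) S a v k"
proof -
  have link: "\<exists>k. reach H (S - C) S a u k"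
    if jr: "reach H (S - C) S a j k'" and j: "j \<in> S - C" and u: "u \<in> S - C"
      and cr: "reach G {j} S j u k" for j k' u k
  proof (cases "j = u")
    case True
    then show ?thesis using jr by blast
  next
    case False
    have "reach G {j, u} S j u k" using reach_mono[OF cr] by blast
    then obtain ns ss where cp: "nontrivial_collider_path G j ns ss u" "nonendpoints ns \<subseteq> S"
      using collider_path_of_reach False by metis
    from cov[OF cp(1)] obtain ns' ss' where cp': "nontrivial_collider_path H j ns' ss' u"
      and sub: "\<forall>d\<in>nonendpoints ns'. d \<in> an G {j, u} \<or> d \<in> (\<Union>c\<in>nonendpoints ns. an G {c})"
      by (auto simp: covered_in_def)
    have "an G {j, u} \<subseteq> S" using an_an[OF assms(1), of "{j, u}" B] j u S by blast
    moreover have "an G {c} \<subseteq> S" if "c \<in> nonendpoints ns" for c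
      using an_an[OF assms(1), of "{c}" B] cp(2) S that by blast
    ultimately have "nonendpoints ns' \<subseteq> S" using sub by blast
    then obtain k'' where "reach H {j} S j u k''" using reach_of_collider_path[OF cp'] by blast
    then have "reach H (S - C) S j u k''"
      using reach_mono j by (metis empty_subsetI insert_subset order_refl)
    then show ?thesis using reach_trans[OF jr] j by blast
  qed
  from r have "\<exists>j\<in>S - C. (\<exists>k'. reach H (S - C) S a j k') \<and> reach G {j} S j v k"
  proof induction
    case start
    then show ?case using a assms(3) by (metis reach.start)
  next
    case (step u k s w)
    then obtain j k' where j: "j \<in> S - C" "reach H (S - C) S a j k'" "reach G {j} S j u k" by blast
    show ?case
    proof (cases "k \<and> neck (start_mark s)")
      case True
      then have "reach G {j} S j w (neck (end_mark s))"
        using reach.step[OF j(3) step.hyps(2,3)] step.hyps(4) by simp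
      then show ?thesis using j by blast
    next
      case False
      then have u: "u \<in> S - C" using step.hyps(4) by auto
      have "reach G {u} S u w (neck (end_mark s))"
        using reach.step[OF reach.start step.hyps(2,3)] reach_in_nodes[OF step.hyps(1)] by simp
      then show ?thesis using link[OF j(2,1) u j(3)] u by blast
    qed
  qed
  then show ?thesis using link v by blast
qed

text \<open>
  A collider \<open>u\<close> outside \<open>an C\<close> is an ancestor of \<open>a\<close> or of \<open>v\<close>.  In the first case \<open>u\<close> is reached from
  \<open>a\<close> against the directed path and need not be a collider any more; in the second case the directed
  path completes the connection to \<open>v\<close> at once.
\<close>

lemma reach_repair:
  assumes G: "cDG G" and r: "reach G (S - C) S a v k" and S: "S = an G ({a, v} \<union> C)"
  shows "\<exists>k. reach G (- C) (an G C) a v k"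
proof -
  let ?R = "reach G (- C) (an G C) a"
  have outside: "x \<notin> C" if "x \<in> nodes G" "x \<notin> an G C" for x
    using that subset_an[OF G, of x C] by blast
  have down: "\<exists>k. ?R v k"
    if "(u, v) \<in> (directed G)\<^sup>*" "u \<notin> an G C" "?R u k" for u k
    using that
  proof (induction arbitrary: k rule: converse_rtrancl_induct)
    case (step y z)
    have "z \<in> nodes G" "y \<in> nodes G" using step.hyps(1) G by (auto simp: cDG_def)
    moreover have "z \<notin> an G C" using an_directed[OF G step.hyps(1)] step.prems(1) by blast
    moreover have "?R z True"
      using reach_forward[OF step.prems(2) step.hyps(1)] calculation(1,2) outside step.prems(1) by simp
    ultimately show ?case using step.IH by blast
  qed blast
  have up: "?R u False" if "(u, a) \<in> (directed G)\<^sup>*" "u \<notin> an G C" "a \<in> nodes G" for u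
    using that
  proof (induction rule: converse_rtrancl_induct)
    case base
    then show ?case by (simp add: reach.start)
  next
    case (step y z)
    have zn: "z \<in> nodes G" "y \<in> nodes G" using step.hyps(1) G by (auto simp: cDG_def)
    have z: "z \<notin> an G C" using an_directed[OF G step.hyps(1)] step.prems(1) by blast
    then have "?R z False" using step.IH step.prems by blast
    from reach.step[OF this, of Backward y] show ?case
      using step.hyps(1) zn outside[OF zn(1) z] by (simp add: neck_def)
  qed
  have a: "a \<in> nodes G" using r by (induction rule: reach.induct) auto
  have "(\<exists>k. ?R v k) \<or> ?R u k" if "reach G (S - C) S a u k" for u k
    using that
  proof (induction rule: reach.induct)
    case start
    then show ?case by (simp add: reach.start)
  next
    case (step u k s w)
    show ?case
    proof (cases "\<exists>k. ?R v k")
      case False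
      then have R: "?R u k" using step.IH by blast
      have "\<exists>k. ?R u k \<and> u \<in> (if k \<and> neck (start_mark s) then an G C else - C)"
      proof (cases "k \<and> neck (start_mark s) \<and> u \<notin> an G C")
        case True
        then have u: "u \<in> S" "u \<notin> an G C" using step.hyps(4) by auto
        have un: "u \<in> nodes G" using reach_in_nodes[OF R] .
        have "\<not> (\<exists>c\<in>C. (u, c) \<in> (directed G)\<^sup>*)" using u(2) un an_conv_rtrancl[OF G] by simp
        moreover have "(u, v) \<notin> (directed G)\<^sup>*" using down[OF _ u(2) R] False by blast
        ultimately have "(u, a) \<in> (directed G)\<^sup>*" using u(1) S an_conv_rtrancl[OF G] by auto
        then have "?R u False" using up u(2) a by blast
        then show ?thesis using outside[OF un u(2)] by (intro exI[of _ False]) simp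
      next
        case False
        then have "u \<in> (if k \<and> neck (start_mark s) then an G C else - C)"
          using step.hyps(4) by (simp split: if_splits)
        then show ?thesis using R by blast
      qed
      then show ?thesis using reach.step[OF _ step.hyps(2,3)] by blast
    qed simp
  qed
  then show ?thesis using r by blast
qed

section \<open>Markov equivalence\<close>

lemma Markov_equivalent_iff:
  assumes "nodes G = V" "nodes H = V"
  shows "Markov_equivalent G H \<longleftrightarrow> (\<forall>a\<in>V. \<forall>b\<in>V. \<forall>C\<subseteq>V.
    (\<exists>ns ss. mu_connecting G a ns ss b C) \<longleftrightarrow> (\<exists>ns ss. mu_connecting H a ns ss b C))"
    (is "_ \<longleftrightarrow> ?R")
proof
  assume M: "Markov_equivalent G H"
  show ?R
  proof (intro ballI allI impI)
    fix a b C assume "a \<in> V" "b \<in> V" "C \<subseteq> V"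
    then have "mu_separated G {a} {b} C \<longleftrightarrow> mu_separated H {a} {b} C"
      using M assms unfolding Markov_equivalent_def independence_model_def by (auto simp: set_eq_iff)
    then show "(\<exists>ns ss. mu_connecting G a ns ss b C) \<longleftrightarrow> (\<exists>ns ss. mu_connecting H a ns ss b C)"
      unfolding mu_separated_def by blast
  qed
next
  assume R: ?R
  have "mu_separated G A B C \<longleftrightarrow> mu_separated H A B C" if "A \<subseteq> V" "B \<subseteq> V" "C \<subseteq> V" for A B C
    unfolding mu_separated_def using R that by (metis subsetD)
  then show "Markov_equivalent G H"
    using assms unfolding Markov_equivalent_def independence_model_def by auto
qed

text \<open>The last edge of a \<open>\<mu>\<close>-connecting walk has its tail outside the conditioning set, so at \<open>a\<close> here.\<close>

lemma directed_iff_mu_connected: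
  assumes "cDG G" "a \<in> nodes G"
  shows "(a, b) \<in> directed G \<longleftrightarrow> (\<exists>ns ss. mu_connecting G a ns ss b (nodes G - {a}))"
proof -
  have "v = a" if "reach G N M a v k" "v \<notin> nodes G - {a}" for N M v k
    using that reach_in_nodes by fastforce
  then show ?thesis
    unfolding mu_connected_iff_reach[OF assms(1)] using reach.start[OF assms(2)] by blast
qed

lemma mu_connected_transfer:
  assumes G: "cDG G" and H: "cDG H" and nodes: "nodes G = nodes H"
    and directed: "directed G = directed H"
    and cov: "\<And>x y ns ss. nontrivial_collider_path G x ns ss y \<Longrightarrow> covered_in G H x ns y"
    and mu: "\<exists>ns ss. mu_connecting G a ns ss b C" and aV: "a \<in> nodes G"
  shows "\<exists>ns ss. mu_connecting H a ns ss b C"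
proof -
  obtain v k where a: "a \<notin> C" and r: "reach G (- C) (an G C) a v k" and v: "v \<notin> C"
    and d: "(v, b) \<in> directed G"
    using mu mu_connected_iff_reach[OF G, of a b C] by blast
  define S where "S = an G ({a, v} \<union> C)"
  have vn: "v \<in> nodes G" using reach_in_nodes[OF r] .
  have aS: "a \<in> S" and vS: "v \<in> S"
    unfolding S_def using aV vn by (auto intro: subset_an[OF G])
  have "an G C \<subseteq> S" unfolding S_def by (rule an_mono) blast
  then have "reach G (S - C) S a v k"
    using reach_within_ancestral[OF G S_def aS _ r vS] by blast
  then have "\<exists>k. reach H (S - C) S a v k"
    by (rule reach_transfer[OF G H nodes S_def, rotated]) (use aS vS a v cov in blast)+
  then obtain k' where r': "reach H (S - C) S a v k'" ..
  have "S = an H ({a, v} \<union> C)" unfolding S_def by (rule an_same_directed[OF G H nodes directed])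
  then have "\<exists>k. reach H (- C) (an H C) a v k" by (rule reach_repair[OF H r'])
  then show ?thesis using a v d directed mu_connected_iff_reach[OF H, of a b C] by auto
qed

lemma covered_of_Markov_equivalent:
  assumes G: "cDG G" and H: "cDG H" and nodes: "nodes G = nodes H"
    and directed: "directed G = directed H" and loops: "contains_every_loop G"
    and M: "Markov_equivalent G H" and cp: "nontrivial_collider_path G a ns ss b"
  shows "covered_in G H a ns b"
proof -
  have p: "path G a ns ss b" and ne: "ss \<noteq> []" using cp by (auto simp: nontrivial_collider_path_def)
  have W: "walk G a ns ss b" and dist: "distinct ns" using p by (auto simp: path_def)
  have len: "length ns = Suc (length ss)" and sub: "set ns \<subseteq> nodes G" using W by (auto simp: walk_def)
  have a0: "ns ! 0 = a" and bl: "ns ! length ss = b" using walk_hd_nth[OF W] walk_last_nth[OF W] .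
  have an: "a \<in> nodes G" and bn: "b \<in> nodes G"
    using a0 bl sub len by (metis lessI nth_mem subsetD zero_less_Suc)+
  have ab: "a \<noteq> b"
    using a0 bl dist ne len by (metis length_0_conv lessI nth_eq_iff_index_eq zero_less_Suc)
  have inner: "nonendpoints ns \<subseteq> nodes G - {a, b}"
  proof
    fix x assume "x \<in> nonendpoints ns"
    then obtain i where i: "0 < i" "i < length ss" "x = ns ! i"
      using nonendpoints_conv_nth[OF len] by auto
    have "x \<noteq> a" "x \<noteq> b"
      using i a0 bl dist len by (metis less_Suc_eq nat_less_le nth_eq_iff_index_eq zero_less_Suc)+
    then show "x \<in> nodes G - {a, b}" using i sub len by auto
  qed
  define B where "B = {a, b} \<union> nonendpoints ns"
  define S where "S = an H B"
  define C where "C = S - {a, b}"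
  have SG: "S = an G B" unfolding S_def using an_same_directed[OF G H nodes directed] by simp
  have BS: "B \<subseteq> S"
    unfolding SG using an bn inner by (auto simp: B_def intro: subset_an[OF G])
  have CV: "C \<subseteq> nodes G" using an_subset_nodes[OF G] SG C_def by blast
  have "nonendpoints ns \<subseteq> C" using inner BS by (auto simp: C_def B_def)
  then have "nonendpoints ns \<subseteq> an G C" using subset_an[OF G, of _ C] CV by blast
  then obtain k where "reach G {a} (an G C) a b k" using reach_of_collider_path[OF cp] by blast
  then have "reach G (- C) (an G C) a b k" using reach_mono C_def by fastforce
  \<comment> \<open>The given path may end without a head at \<open>b\<close>; the loop supplies one, and \<open>b\<close> is a noncollider
    outside \<open>C\<close> then.\<close>
  moreover have "(b, b) \<in> directed G" using loops bn by (simp add: contains_every_loop_def)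
  ultimately have "\<exists>ns ss. mu_connecting G a ns ss b C"
    using mu_connected_iff_reach[OF G, of a b C] by (auto simp: C_def)
  then have "\<exists>ns ss. mu_connecting H a ns ss b C"
    using M Markov_equivalent_iff[OF refl nodes[symmetric]] an bn CV by blast
  then obtain v k where r: "reach H (- C) (an H C) a v k" and v: "v \<notin> C"
    and d: "(v, b) \<in> directed H"
    using mu_connected_iff_reach[OF H, of a b C] by blast
  have aS: "a \<in> S" and bS: "b \<in> S" using BS by (auto simp: B_def)
  have vS: "v \<in> S" using an_directed[OF H d] bS by (simp add: S_def)
  have "an H C \<subseteq> S" unfolding S_def by (rule an_an[OF H]) (auto simp: C_def S_def)
  then have "reach H (S - C) S a v k" using reach_within_ancestral[OF H S_def aS _ r vS] by blast
  then have "reach H (S - C) S a b True"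
    using reach_forward d v vS bn nodes by (metis DiffI)
  \<comment> \<open>Only \<open>a\<close> and \<open>b\<close> can be noncolliders now.\<close>
  moreover have "S - C \<subseteq> {a, b}" by (auto simp: C_def)
  ultimately have "reach H {a, b} S a b True" using reach_mono by (metis order_refl)
  then obtain ns' ss' where cp': "nontrivial_collider_path H a ns' ss' b" "nonendpoints ns' \<subseteq> S"
    using collider_path_of_reach ab by metis
  have "S = an G {a, b} \<union> (\<Union>c\<in>nonendpoints ns. an G {c})"
    unfolding SG B_def an_def by blast
  then show ?thesis using cp' unfolding covered_in_def by blast
qed

theorem theorem31:
  fixes V :: "'v set" and D1 D2 :: "'v cdg"
  assumes "cDG D1" and "cDG D2"
    and "nodes D1 = V" and "nodes D2 = V"
    and "contains_every_loop D1" and "contains_every_loop D2"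
  shows "Markov_equivalent D1 D2 \<longleftrightarrow>
    directed D1 = directed D2 \<and> collider_equivalent D1 D2"
proof
  assume M: "Markov_equivalent D1 D2"
  have "(a, b) \<in> directed D1 \<longleftrightarrow> (a, b) \<in> directed D2" for a b
  proof (cases "a \<in> V \<and> b \<in> V")
    case True
    then show ?thesis
      using directed_iff_mu_connected[OF assms(1), of a b]
        directed_iff_mu_connected[OF assms(2), of a b]
        M Markov_equivalent_iff[OF assms(3,4)] assms(3,4) by (metis Diff_subset)
  next
    case False
    then show ?thesis using assms(1-4) by (auto simp: cDG_def)
  qed
  then have d: "directed D1 = directed D2" by auto
  have M': "Markov_equivalent D2 D1" using M by (simp add: Markov_equivalent_def)
  have "collider_equivalent D1 D2"
    unfolding collider_equivalent_def
    using covered_of_Markov_equivalent[OF assms(1,2) _ d assms(5) M]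
      covered_of_Markov_equivalent[OF assms(2,1) _ d[symmetric] assms(6) M'] assms(3,4) by simp
  then show "directed D1 = directed D2 \<and> collider_equivalent D1 D2" using d by blast
next
  assume R: "directed D1 = directed D2 \<and> collider_equivalent D1 D2"
  then have cov: "nontrivial_collider_path D1 x ns ss y \<Longrightarrow> covered_in D1 D2 x ns y"
      "nontrivial_collider_path D2 x ns ss y \<Longrightarrow> covered_in D2 D1 x ns y" for x y ns ss
    unfolding collider_equivalent_def by blast+
  show "Markov_equivalent D1 D2"
    unfolding Markov_equivalent_iff[OF assms(3,4)]
  proof (intro ballI allI impI iffI)
    fix a b C assume "a \<in> V"
    then have a: "a \<in> nodes D1" "a \<in> nodes D2" using assms(3,4) by auto
    have n: "nodes D1 = nodes D2" using assms(3,4) by simp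
    show "\<exists>ns ss. mu_connecting D2 a ns ss b C" if "\<exists>ns ss. mu_connecting D1 a ns ss b C"
      by (rule mu_connected_transfer[OF assms(1,2) n]) (use R a that cov(1) in blast)+
    show "\<exists>ns ss. mu_connecting D1 a ns ss b C" if "\<exists>ns ss. mu_connecting D2 a ns ss b C"
      by (rule mu_connected_transfer[OF assms(2,1) n[symmetric]])
        (use R a that cov(2) in \<open>blast | simp\<close>)+
  qed
qed

end
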